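(* Let $0<l_z<1$ and let $\mathcal F'=\{(x,y,z)\in\mathbb R^3 : z=xy,\ 0\le x\le 1,\ 0\le y\le 1,\ l_z\le z\le 1\}$. Let $$M=\begin{pmatrix}1 & 2l_z-1\\ 2l_z-1 & 1\end{pmatrix}.$$ Then $M$ is positive semidefinite, and $\operatorname{conv}(\mathcal F')$ is exactly the set of $(x,y,z)\in\mathbb R^3$ satisfying the RLT constraint $z\ge x+y-1$, the bound $z\ge l_z$, and the second-order cone constraint $$\sqrt{(\hat x,\hat y)\,M\,(\hat x,\hat y)^T}\le x+y-2z,\qquad\text{where } \hat x:=1-x,\ \hat y:=1-y.$$
   Context: $\operatorname{conv}$ denotes the convex hull in $\mathbb R^3$. "RLT" stands for Reformulation-Linearization Technique; the only RLT constraint used is written out in the claim. *)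

theory Defs
  imports "HOL-Analysis.Analysis"
begin

definition positive_semidefinite :: "real ^ 'n ^ 'n \<Rightarrow> bool" where
  "positive_semidefinite A \<longleftrightarrow> transpose A = A \<and> (\<forall>v. 0 \<le> v \<bullet> (A *v v))"

definition bilinear_set :: "real \<Rightarrow> (real ^ 3) set" where
  "bilinear_set l =
    {vector [x, y, z] | x y z.
      z = x * y \<and> 0 \<le> x \<and> x \<le> 1 \<and> 0 \<le> y \<and> y \<le> 1 \<and> l \<le> z \<and> z \<le> 1}"

definition soc_matrix :: "real \<Rightarrow> real ^ 2 ^ 2" where
  "soc_matrix l = vector [vector [1, 2 * l - 1], vector [2 * l - 1, 1]]"

end

theory Submission
  imports Defs
begin

text \<open>
  Put \<open>a = 1 - x\<close>, \<open>b = 1 - y\<close>, \<open>t = 1 - z\<close>. Then the cone constraint says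
  \<open>t\<^sup>2 - t (a + b) + (1 - l) a b \<ge> 0\<close> and \<open>a + b \<le> 2 t\<close>, while the RLT constraint is
  \<open>t \<le> a + b\<close>; both are homogeneous in \<open>(a, b, t)\<close>. Hence the described set is the union of
  the segments from the apex \<open>(1, 1, 1)\<close> to the slice \<open>z = l\<close>. That slice is the region
  between the hyperbola \<open>x y = l\<close> and the chord \<open>x + y = 1 + l\<close>, so each of its points lies on
  a segment of direction \<open>(1, -1)\<close> joining two points of the hyperbola.
\<close>

text \<open>The matrix has eigenvectors \<open>(1, -1)\<close> and \<open>(1, 1)\<close> with
  eigenvalues \<open>2 * (1 - l)\<close> and \<open>2 * l\<close>; diagonalizing gives this weighted
  sum of squares.\<close>

lemma soc_matrix_quadratic_form:
  "w \<bullet> (soc_matrix l *v w) = (1 - l) * (w $ 1 - w $ 2)\<^sup>2 + l * (w $ 1 + w $ 2)\<^sup>2"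
  by (simp add: soc_matrix_def inner_vec_def matrix_vector_mult_def sum_2 power2_eq_square
      algebra_simps)

lemma positive_semidefinite_soc_matrix:
  assumes "0 \<le> l" "l \<le> 1"
  shows "positive_semidefinite (soc_matrix l)"
proof -
  have "transpose (soc_matrix l) = soc_matrix l"
    by (simp add: vec_eq_iff forall_2 transpose_def soc_matrix_def)
  then show ?thesis
    using assms by (simp add: positive_semidefinite_def soc_matrix_quadratic_form)
qed

text \<open>Kept literally in the form of the set in the theorem, so that folding the definition
  there suffices.\<close>

definition soc_relaxation :: "real \<Rightarrow> (real ^ 3) set" where
  "soc_relaxation l =
    {vector [x, y, z] | x y z.
      z \<ge> x + y - 1 \<and> z \<ge> l \<and>
      (let w = vector [1 - x, 1 - y] in
        sqrt (w \<bullet> (soc_matrix l *v w)) \<le> x + y - 2 * z)}"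

lemma vector_3_eq_iff:
  fixes p :: "'a::zero ^ 3"
  shows "p = vector [x, y, z] \<longleftrightarrow> p $ 1 = x \<and> p $ 2 = y \<and> p $ 3 = z"
  by (simp add: vec_eq_iff forall_3)

lemma vector_mem_soc_relaxation_iff:
  "vector [x, y, z] \<in> soc_relaxation l \<longleftrightarrow>
    x + y - 1 \<le> z \<and> l \<le> z \<and>
    sqrt ((1 - l) * (x - y)\<^sup>2 + l * (2 - x - y)\<^sup>2) \<le> x + y - 2 * z"
proof -
  have "(1 - l) * (1 - x - (1 - y))\<^sup>2 + l * (1 - x + (1 - y))\<^sup>2 =
      (1 - l) * (x - y)\<^sup>2 + l * (2 - x - y)\<^sup>2" for x y
    by (simp add: power2_eq_square algebra_simps)
  then show ?thesis
    by (auto simp: soc_relaxation_def Let_def soc_matrix_quadratic_form vector_3_eq_iff)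
qed

text \<open>With nonnegative weights, the sum of squares under the root is the squared modulus of a
  complex number that is affine in \<open>p\<close>. Convexity then reduces to the triangle
  inequality.\<close>

lemma soc_relaxation_eq_norm:
  assumes "0 \<le> l" "l \<le> 1"
  shows "soc_relaxation l =
    {p. p $ 1 + p $ 2 - 1 \<le> p $ 3 \<and> l \<le> p $ 3 \<and>
      cmod (Complex (sqrt (1 - l) * (p $ 1 - p $ 2)) (sqrt l * (2 - p $ 1 - p $ 2)))
        \<le> p $ 1 + p $ 2 - 2 * p $ 3}"
    (is "_ = ?N")
proof (rule set_eqI)
  fix p :: "real ^ 3"
  have "p = vector [p $ 1, p $ 2, p $ 3]"
    by (simp add: vector_3_eq_iff)
  then show "p \<in> soc_relaxation l \<longleftrightarrow> p \<in> ?N"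
    using vector_mem_soc_relaxation_iff[of "p $ 1" "p $ 2" "p $ 3" l] assms
    by (simp add: complex_norm power_mult_distrib)
qed

lemma convex_soc_relaxation:
  assumes "0 \<le> l" "l \<le> 1"
  shows "convex (soc_relaxation l)"
proof (rule convexI)
  fix p q :: "real ^ 3" and u v :: real
  assume p: "p \<in> soc_relaxation l" and q: "q \<in> soc_relaxation l"
    and uv: "0 \<le> u" "0 \<le> v" "u + v = 1"
  define c where
    "c p = Complex (sqrt (1 - l) * (p $ 1 - p $ 2)) (sqrt l * (2 - p $ 1 - p $ 2))"
    for p :: "real ^ 3"
  have mem: "r \<in> soc_relaxation l \<longleftrightarrow> r $ 1 + r $ 2 - 1 \<le> r $ 3 \<and> l \<le> r $ 3 \<and>
      cmod (c r) \<le> r $ 1 + r $ 2 - 2 * r $ 3" for r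
    using soc_relaxation_eq_norm[OF assms] by (simp add: c_def)
  have v: "v = 1 - u"
    using uv by simp
  \<comment> \<open>The constant 2 makes \<open>c\<close> affine rather than linear, hence the
    substitution \<open>v = 1 - u\<close>.\<close>
  have "c (u *\<^sub>R p + v *\<^sub>R q) = u *\<^sub>R c p + v *\<^sub>R c q"
    by (simp add: c_def complex_eq_iff v algebra_simps)
  then have "cmod (c (u *\<^sub>R p + v *\<^sub>R q)) \<le> u * cmod (c p) + v * cmod (c q)"
    using norm_triangle_ineq[of "u *\<^sub>R c p" "v *\<^sub>R c q"] uv by simp
  also have "\<dots> \<le> u * (p $ 1 + p $ 2 - 2 * p $ 3) + v * (q $ 1 + q $ 2 - 2 * q $ 3)"
    using p q uv by (intro add_mono mult_left_mono) (simp_all add: mem)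
  finally have "cmod (c (u *\<^sub>R p + v *\<^sub>R q)) \<le>
      u * (p $ 1 + p $ 2 - 2 * p $ 3) + v * (q $ 1 + q $ 2 - 2 * q $ 3)" .
  moreover have "u * (p $ 1 + p $ 2 - 1) + v * (q $ 1 + q $ 2 - 1) \<le> u * p $ 3 + v * q $ 3"
    "u * l + v * l \<le> u * p $ 3 + v * q $ 3"
    using p q uv by (intro add_mono mult_left_mono; simp add: mem)+
  ultimately show "u *\<^sub>R p + v *\<^sub>R q \<in> soc_relaxation l"
    by (simp add: mem v algebra_simps)
qed

text \<open>Squaring removes the root once the right-hand side is nonnegative, and the difference of
  the squares is four times the quadratic, which is homogeneous in
  \<open>(1 - x, 1 - y, 1 - z)\<close>.\<close>

lemma soc_constraint_iff:
  fixes x y z l :: real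
  assumes "0 \<le> l" "l \<le> 1"
  shows "sqrt ((1 - l) * (x - y)\<^sup>2 + l * (2 - x - y)\<^sup>2) \<le> x + y - 2 * z \<longleftrightarrow>
    0 \<le> x + y - 2 * z \<and>
    0 \<le> (1 - z)\<^sup>2 - (1 - z) * ((1 - x) + (1 - y)) + (1 - l) * ((1 - x) * (1 - y))"
proof -
  let ?q = "(1 - l) * (x - y)\<^sup>2 + l * (2 - x - y)\<^sup>2"
  have "0 \<le> ?q"
    using assms by simp
  then have "sqrt ?q \<le> x + y - 2 * z \<longleftrightarrow> 0 \<le> x + y - 2 * z \<and> ?q \<le> (x + y - 2 * z)\<^sup>2"
    by (meson order_trans real_le_lsqrt real_sqrt_ge_zero sqrt_le_D)
  moreover have "(x + y - 2 * z)\<^sup>2 - ?q =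
      4 * ((1 - z)\<^sup>2 - (1 - z) * ((1 - x) + (1 - y)) + (1 - l) * ((1 - x) * (1 - y)))"
    by (simp add: power2_eq_square algebra_simps)
  moreover have "a \<le> c \<longleftrightarrow> 0 \<le> e" if "c - a = 4 * e" for a c e :: real
    using that by linarith
  ultimately show ?thesis
    by presburger
qed

lemma bilinear_set_subset_soc_relaxation:
  assumes "0 \<le> l" "l \<le> 1"
  shows "bilinear_set l \<subseteq> soc_relaxation l"
proof
  fix p assume "p \<in> bilinear_set l"
  then obtain x y where p: "p = vector [x, y, x * y]"
    and xy: "0 \<le> x" "x \<le> 1" "0 \<le> y" "y \<le> 1" "l \<le> x * y"
    by (auto simp: bilinear_set_def)
  have nonneg: "0 \<le> (1 - x) * (1 - y)" "0 \<le> x * (1 - y)" "0 \<le> y * (1 - x)"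
    using xy by simp_all
  \<comment> \<open>On the surface \<open>z = x * y\<close> the quadratic factors, because
    \<open>1 - x * y\<close> equals \<open>(1 - x) + (1 - y) - (1 - x) * (1 - y)\<close>.\<close>
  have "(1 - x * y)\<^sup>2 - (1 - x * y) * ((1 - x) + (1 - y)) + (1 - l) * ((1 - x) * (1 - y)) =
      (1 - x) * (1 - y) * (x * y - l)"
    by (simp add: power2_eq_square algebra_simps)
  also have "\<dots> \<ge> 0"
    using nonneg xy by (intro mult_nonneg_nonneg) simp_all
  finally show "p \<in> soc_relaxation l"
    using nonneg xy unfolding p vector_mem_soc_relaxation_iff soc_constraint_iff[OF assms]
    by (simp add: algebra_simps)
qed

lemma slice_mem_hull_bilinear_set:
  assumes l: "0 < l" "l < 1" and xy: "l \<le> x * y" "x + y \<le> 1 + l" and pos: "0 < x + y"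
  shows "vector [x, y, l] \<in> convex hull (bilinear_set l)"
proof -
  \<comment> \<open>\<open>u\<close> and \<open>v\<close> are the roots of
    \<open>T\<^sup>2 - s * T + l\<close>, so \<open>(u, v)\<close> and \<open>(v, u)\<close> are the
    points of the hyperbola with the same coordinate sum as \<open>(x, y)\<close>. Positivity of
    \<open>s\<close> selects the branch in the positive quadrant.\<close>
  define s where "s = x + y"
  define d where "d = sqrt (s\<^sup>2 - 4 * l)"
  define u where "u = (s - d) / 2"
  define v where "v = (s + d) / 2"
  have "s\<^sup>2 - 4 * l = (x - y)\<^sup>2 + 4 * (x * y - l)"
    by (simp add: s_def power2_eq_square algebra_simps)
  moreover have "0 \<le> (x - y)\<^sup>2 + 4 * (x * y - l)"
    using xy by (intro add_nonneg_nonneg) simp_all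
  ultimately have disc: "0 \<le> s\<^sup>2 - 4 * l"
    by simp
  then have d: "0 \<le> d" "d\<^sup>2 = s\<^sup>2 - 4 * l"
    by (simp_all add: d_def)
  have sum: "u + v = s" and "u \<le> v"
    using d by (simp_all add: u_def v_def field_simps)
  have prod: "u * v = l"
    using d by (simp add: u_def v_def field_simps power2_eq_square)
  have "0 < v"
    using sum \<open>u \<le> v\<close> pos s_def by linarith
  then have "0 < u"
    using prod l by (metis zero_less_mult_pos2)
  have "u < 1"
    using sum \<open>u \<le> v\<close> xy l s_def by linarith
  \<comment> \<open>The chord condition enters here: it keeps the larger root \<open>v\<close> from
    exceeding 1.\<close>
  have "(1 - u) * (1 - v) = 1 - s + l"
    using sum prod by (simp add: algebra_simps)
  then have "0 \<le> (1 - u) * (1 - v)"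
    using xy s_def by simp
  then have "v \<le> 1"
    using \<open>u < 1\<close> by (simp add: zero_le_mult_iff)
  have ends: "vector [u, v, l] \<in> bilinear_set l" "vector [v, u, l] \<in> bilinear_set l"
    using prod \<open>0 < u\<close> \<open>0 < v\<close> \<open>u < 1\<close> \<open>v \<le> 1\<close> l
    by (auto simp: bilinear_set_def vector_3_eq_iff mult.commute)
  \<comment> \<open>At \<open>T = x\<close> the polynomial with roots \<open>u\<close>,
    \<open>v\<close> takes the value \<open>l - x * y\<close>, which is nonpositive, so
    \<open>x\<close> lies between the roots.\<close>
  have "(x - u) * (x - v) = x * x - (u + v) * x + u * v"
    by (simp add: algebra_simps)
  also have "\<dots> = l - x * y"
    by (simp add: sum prod s_def algebra_simps)
  finally have "(x - u) * (x - v) \<le> 0"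
    using xy by simp
  then have x: "u \<le> x" "x \<le> v"
    using \<open>u \<le> v\<close> by (auto simp: mult_le_0_iff)
  show ?thesis
  proof (cases "u = v")
    case True
    then have "x = u" "y = v"
      using x sum by (simp_all add: s_def)
    then show ?thesis
      using ends by (simp add: hull_inc)
  next
    case False
    define k where "k = (v - x) / (v - u)"
    have "0 < v - u"
      using False \<open>u \<le> v\<close> by simp
    then have k: "0 \<le> k" "0 \<le> 1 - k"
      using x by (simp_all add: k_def)
    have "k * (v - u) = v - x"
      using \<open>0 < v - u\<close> by (simp add: k_def)
    then have "k * u + (1 - k) * v = x" "k * v + (1 - k) * u = y"
      using sum by (simp_all add: s_def algebra_simps)
    then have "vector [x, y, l] = k *\<^sub>R vector [u, v, l] + (1 - k) *\<^sub>R (vector [v, u, l] :: real ^ 3)"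
      by (simp add: vec_eq_iff forall_3 algebra_simps)
    also have "\<dots> \<in> convex hull (bilinear_set l)"
      using ends k by (intro convexD[OF convex_convex_hull]) (simp_all add: hull_inc)
    finally show ?thesis .
  qed
qed

lemma soc_relaxation_subset_hull:
  assumes l: "0 < l" "l < 1"
  shows "soc_relaxation l \<subseteq> convex hull (bilinear_set l)"
proof
  fix p assume p: "p \<in> soc_relaxation l"
  obtain x y z where pxyz: "p = vector [x, y, z]"
    using p by (auto simp: soc_relaxation_def)
  define a b t where "a = 1 - x" and "b = 1 - y" and "t = 1 - z"
  have bounds: "t \<le> a + b" "t \<le> 1 - l" "a + b \<le> 2 * t"
    and quad: "0 \<le> t\<^sup>2 - t * (a + b) + (1 - l) * (a * b)"
    using p l unfolding pxyz vector_mem_soc_relaxation_iff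
    by (auto simp: soc_constraint_iff a_def b_def t_def)
  have "0 \<le> t"
    using bounds by linarith
  have apex: "vector [1, 1, 1] \<in> convex hull (bilinear_set l)"
    using l by (intro hull_inc) (auto simp: bilinear_set_def vector_3_eq_iff)
  show "p \<in> convex hull (bilinear_set l)"
  proof (cases "t = 0")
    case True
    \<comment> \<open>At height \<open>z = 1\<close> only the apex survives: \<open>a = - b\<close>
      turns \<open>0 \<le> a * b\<close> into \<open>0 \<le> - b\<^sup>2\<close>.\<close>
    then have ab: "a + b = 0" "0 \<le> a * b"
      using bounds quad l by (simp_all add: zero_le_mult_iff)
    then have "a = - b"
      by simp
    then have "a = 0" "b = 0"
      using ab by (auto simp: zero_le_mult_iff)
    then have "p = vector [1, 1, 1]"
      using True by (simp add: pxyz a_def b_def t_def)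
    then show ?thesis
      using apex by simp
  next
    case False
    then have "0 < t"
      using \<open>0 \<le> t\<close> by simp
    define m where "m = 1 - l"
    \<comment> \<open>Dividing \<open>(a, b, t)\<close> by \<open>r\<close> moves the point along
      its ray from the apex to the slice \<open>z = l\<close>; the bound \<open>l \<le> z\<close>
      gives \<open>r \<le> 1\<close>.\<close>
    define r where "r = t / m"
    have "0 < m"
      using l by (simp add: m_def)
    then have r: "0 < r" "r \<le> 1" and t: "t = r * m"
      using \<open>0 < t\<close> bounds by (simp_all add: r_def m_def)
    define A B where "A = a / r" and "B = b / r"
    have a: "a = r * A" and b: "b = r * B"
      using r by (simp_all add: A_def B_def)
    have "r * m \<le> r * (A + B)" "r * (A + B) \<le> r * (2 * m)"
      using bounds by (simp_all add: a b t algebra_simps)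
    then have AB: "m \<le> A + B" "A + B \<le> 2 * m"
      using r by simp_all
    \<comment> \<open>Homogeneity pulls out \<open>r\<^sup>2\<close>; the last factor is
      \<open>(1 - A) * (1 - B) - l\<close>, the hyperbola condition in the slice.\<close>
    have "t\<^sup>2 - t * (a + b) + m * (a * b) = (r\<^sup>2 * m) * (m - (A + B) + A * B)"
      by (simp add: a b t power2_eq_square algebra_simps)
    then have "0 \<le> (r\<^sup>2 * m) * (m - (A + B) + A * B)"
      using quad by (simp add: m_def)
    moreover have "0 < r\<^sup>2 * m"
      using r \<open>0 < m\<close> by simp
    ultimately have "0 \<le> m - (A + B) + A * B"
      by (simp add: zero_le_mult_iff)
    then have "l \<le> (1 - A) * (1 - B)"
      by (simp add: m_def algebra_simps)
    \<comment> \<open>In \<open>AB\<close>, the lower bound is the chord condition, and the upper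
      bound gives the coordinate sum at least \<open>2 * l\<close>, hence positive.\<close>
    then have slice: "vector [1 - A, 1 - B, l] \<in> convex hull (bilinear_set l)"
      using AB l by (intro slice_mem_hull_bilinear_set) (simp_all add: m_def)
    have "p = r *\<^sub>R vector [1 - A, 1 - B, l] + (1 - r) *\<^sub>R vector [1, 1, 1]"
      using a b t by (simp add: pxyz vec_eq_iff forall_3 a_def b_def t_def m_def algebra_simps)
    also have "\<dots> \<in> convex hull (bilinear_set l)"
      using slice apex r by (intro convexD[OF convex_convex_hull]) simp_all
    finally show ?thesis .
  qed
qed

theorem proposition2:
  fixes l\<^sub>z :: real
  assumes "0 < l\<^sub>z" and "l\<^sub>z < 1"
  shows "positive_semidefinite (soc_matrix l\<^sub>z) \<and>
    convex hull (bilinear_set l\<^sub>z) =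
      {vector [x, y, z] | x y z.
        z \<ge> x + y - 1 \<and> z \<ge> l\<^sub>z \<and>
        (let w = vector [1 - x, 1 - y] in
          sqrt (w \<bullet> (soc_matrix l\<^sub>z *v w)) \<le> x + y - 2 * z)}"
proof -
  have "convex hull (bilinear_set l\<^sub>z) = soc_relaxation l\<^sub>z"
    using assms
    by (intro equalityI hull_minimal bilinear_set_subset_soc_relaxation convex_soc_relaxation
        soc_relaxation_subset_hull) simp_all
  then show ?thesis
    using assms by (simp add: positive_semidefinite_soc_matrix flip: soc_relaxation_def)
qed

end
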